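(* Let $\{\Phi_n, n\ge 0\}$ be a Markov chain on $\mathsf{X}$. Assume that there exist measurable functions $W : \mathsf{X} \to [1,\infty)$ and $n : \mathsf{X} \to \{1,2,\dots\}$, constants $\beta \in (0,1)$ and $b<\infty$, and a measurable set $\mathcal{C}$ such that for all $x \in \mathsf{X}$, $$\mathbb{E}_x\left[ W(\Phi_{n(\Phi_0)}) \right] \leq \beta W(x) + b\, \mathbf{1}_{\mathcal{C}}(x).$$ If there exists a strictly increasing function $R: (0,\infty)\rightarrow(0,\infty)$ satisfying one of the following conditions: (i) $t \mapsto R(t)/t$ is non-increasing and $R \circ n \leq W$ on $\mathsf{X}$; (ii) $R$ is a convex continuously differentiable function such that $R'$ is log-concave and $R^{-1}(W(x)) - R^{-1}(\beta W(x)) \geq n(x)$ for all $x\in\mathsf{X}$; then there exists a constant $K<\infty$ such that for all $x \in \mathsf{X}$, $$\mathbb{E}_x [ R(\tau_{\mathcal{C}}) ] \leq K \{W(x) + b\,\mathbf{1}_{\mathcal{C}} (x) \}.$$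
   Context: The chain is time-homogeneous on a general state space $\mathsf{X}$; $\mathbb{E}_x$ is expectation for the chain started at $\Phi_0=x$; $\tau_{\mathcal{C}} := \inf\{k\ge 1 : \Phi_k\in\mathcal{C}\}$ is the first return time to $\mathcal{C}$, with $R(\infty):=\lim_{t\to\infty}R(t)$; $\mathbf{1}_{\mathcal{C}}$ is the indicator function. $R^{-1}$ is the inverse of $R$ on its range; condition (ii) implicitly includes that $W(x)$ and $\beta W(x)$ lie in the range of $R$. *)

theory Defs
  imports "HOL-Probability.Probability"
begin

text \<open>
  A time-homogeneous Markov chain on the state space \<open>X\<close> with transition kernel \<open>P\<close>.
  The variables \<open>\<Phi> n\<close> live on one measurable space \<open>\<Omega>\<close>, and \<open>Pr x\<close> is the law on \<open>\<Omega>\<close>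
  under which the chain starts at \<open>x\<close>, so that \<open>E\<^sub>x\<close> is integration with respect to \<open>Pr x\<close>.
  Only the sigma-algebra of \<open>\<Omega>\<close> is used, not its measure.  The initial condition is stated as
  ``\<open>\<Phi> 0\<close> has law \<open>\<delta>\<^sub>x\<close>'', which is meaningful also if \<open>{x}\<close> is not measurable.
  The sub-sigma-algebra in the Markov property is the one generated by \<open>\<Phi> 0, \<dots>, \<Phi> m\<close>.
\<close>

locale markov_chain =
  fixes X :: "'a measure"
    and P :: "'a \<Rightarrow> 'a measure"
    and \<Omega> :: "'w measure"
    and Pr :: "'a \<Rightarrow> 'w measure"
    and \<Phi> :: "nat \<Rightarrow> 'w \<Rightarrow> 'a"
  assumes kernel: "P \<in> X \<rightarrow>\<^sub>M prob_algebra X"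
    and prob_space_Pr: "x \<in> space X \<Longrightarrow> prob_space (Pr x)"
    and sets_Pr: "x \<in> space X \<Longrightarrow> sets (Pr x) = sets \<Omega>"
    and measurable_chain: "\<Phi> m \<in> \<Omega> \<rightarrow>\<^sub>M X"
    and initial: "x \<in> space X \<Longrightarrow> distr (Pr x) X (\<Phi> 0) = return X x"
    and markov_property: "x \<in> space X \<Longrightarrow> A \<in> sets X \<Longrightarrow>
      AE \<omega> in Pr x.
        real_cond_exp (Pr x)
          (vimage_algebra (space \<Omega>) (\<lambda>\<omega>. \<lambda>k\<in>{..m}. \<Phi> k \<omega>) (\<Pi>\<^sub>M k\<in>{..m}. X))
          (\<lambda>\<omega>. indicator A (\<Phi> (Suc m) \<omega>)) \<omega>
        = measure (P (\<Phi> m \<omega>)) A"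

definition return_time :: "(nat \<Rightarrow> 'w \<Rightarrow> 'a) \<Rightarrow> 'a set \<Rightarrow> 'w \<Rightarrow> enat" where
  "return_time \<Phi> C \<omega> = Inf (enat ` {k. 1 \<le> k \<and> \<Phi> k \<omega> \<in> C})"

definition rate_at :: "(real \<Rightarrow> real) \<Rightarrow> enat \<Rightarrow> ennreal" where
  "rate_at R t = (case t of
      enat k \<Rightarrow> ennreal (R (real k))
    | \<infinity> \<Rightarrow> Lim at_top (\<lambda>s::real. ennreal (R s)))"

text \<open>
  Log-concavity is required only of strictly positive functions.  The derivative of a convex,
  strictly increasing, differentiable function on an open interval is always strictly positive.
\<close>

definition log_concave_on :: "real set \<Rightarrow> (real \<Rightarrow> real) \<Rightarrow> bool" where
  "log_concave_on S f \<longleftrightarrow> (\<forall>t\<in>S. 0 < f t) \<and> concave_on S (\<lambda>t. ln (f t))"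

end

(* Sampling the chain after n(x) steps gives E_x R(s + tau) <= E_x R(s + n(x) + tau'), where tau' = 0
   if the chain is then in C and tau' is the return time of the shifted chain otherwise.  Iterated on
   truncated return times, this reduces the theorem to one-block estimates.
   (i) R is subadditive, so a block costs at most R(n(x)) <= W(x), and the drift condition makes the
   costs sum up geometrically.
   (ii) With r = R^{-1} o W, log-concavity of R' makes v |-> R(s + R^{-1}(v)) concave.  By Jensen,
   for x outside C,
     E_x R(s + n(x) + r(Phi_{n(x)})) <= R(s + n(x) + R^{-1}(beta W(x))) <= R(s + r(x)),
   so E_x R(s + tau) <= R(s + r(x)) there.  One more block handles x in C; the slope of the
   supporting line used there is bounded if beta W(x) >= 2 R(1), and otherwise n(x) takes finitely
   many values. *)

theory Submission
  imports Defs
begin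

text \<open>\<open>truncated_value P C g m s x\<close> is \<open>E\<^sub>x (g (s + min \<tau>\<^sub>C m))\<close>.\<close>

primrec truncated_value ::
  "('a \<Rightarrow> 'a measure) \<Rightarrow> 'a set \<Rightarrow> (nat \<Rightarrow> ennreal) \<Rightarrow> nat \<Rightarrow> nat \<Rightarrow> 'a \<Rightarrow> ennreal" where
  "truncated_value P C g 0 s x = g s"
| "truncated_value P C g (Suc m) s x =
    (\<integral>\<^sup>+y. (if y \<in> C then g (Suc s) else truncated_value P C g m (Suc s) y) \<partial>P x)"

text \<open>The event that the first return time exceeds \<open>k\<close>. It is determined by the
  path up to time \<open>k\<close>, so it can serve as the conditioning event in the Markov
  property.\<close>

definition no_return :: "'w measure \<Rightarrow> (nat \<Rightarrow> 'w \<Rightarrow> 'a) \<Rightarrow> 'a set \<Rightarrow> nat \<Rightarrow> 'w set" where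
  "no_return \<Omega> \<Phi> C k = {\<omega> \<in> space \<Omega>. \<forall>j\<in>{1..k}. \<Phi> j \<omega> \<notin> C}"

section \<open>Markov property for nonnegative functions and the law of the chain at a fixed
  time\<close>

context markov_chain
begin

lemma prob_space_kernel: "x \<in> space X \<Longrightarrow> prob_space (P x)"
  using measurable_space[OF kernel] by (simp add: space_prob_algebra)

lemma sets_kernel: "x \<in> space X \<Longrightarrow> sets (P x) = sets X"
  using measurable_space[OF kernel] by (simp add: space_prob_algebra)

lemma space_kernel: "x \<in> space X \<Longrightarrow> space (P x) = space X"
  using sets_kernel sets_eq_imp_space_eq by blast

lemma space_Pr: "x \<in> space X \<Longrightarrow> space (Pr x) = space \<Omega>"
  using sets_Pr sets_eq_imp_space_eq by blast

lemma measurable_chain_Pr: "x \<in> space X \<Longrightarrow> \<Phi> m \<in> Pr x \<rightarrow>\<^sub>M X"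
  using measurable_chain measurable_cong_sets[OF sets_Pr refl] by blast

lemma measurable_nn_integral_kernel:
  assumes "f \<in> borel_measurable X"
  shows "(\<lambda>x. \<integral>\<^sup>+y. f y \<partial>P x) \<in> borel_measurable X"
  using measurable_compose[OF measurable_prob_algebraD[OF kernel]
      nn_integral_measurable_subprob_algebra[OF assms]] .

text \<open>A function and its conditional expectation have the same integral over every event
  \<open>A\<close> of the history, and here the conditional expectation is almost everywhere the
  kernel probability of \<open>B\<close>. Both integrands are bounded by 1, so the identity of real
  integrals transfers to nonnegative ones.\<close>

lemma markov_property_indicator:
  assumes x: "x \<in> space X" and B: "B \<in> sets X"
    and A: "A \<in> sets (vimage_algebra (space \<Omega>) (\<lambda>\<omega>. \<lambda>k\<in>{..m}. \<Phi> k \<omega>) (\<Pi>\<^sub>M k\<in>{..m}. X))"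
  shows "(\<integral>\<^sup>+\<omega>. indicator A \<omega> * indicator B (\<Phi> (Suc m) \<omega>) \<partial>Pr x)
    = (\<integral>\<^sup>+\<omega>. indicator A \<omega> * emeasure (P (\<Phi> m \<omega>)) B \<partial>Pr x)"
proof -
  let ?F = "vimage_algebra (space \<Omega>) (\<lambda>\<omega>. \<lambda>k\<in>{..m}. \<Phi> k \<omega>) (\<Pi>\<^sub>M k\<in>{..m}. X)"
  interpret M: prob_space "Pr x" by (rule prob_space_Pr[OF x])
  have meas: "(\<lambda>\<omega>. \<lambda>k\<in>{..m}. \<Phi> k \<omega>) \<in> Pr x \<rightarrow>\<^sub>M (\<Pi>\<^sub>M k\<in>{..m}. X)"
    by (intro measurable_restrict measurable_chain_Pr x)
  have sub: "subalgebra (Pr x) ?F"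
    unfolding subalgebra_def
  proof
    show "space ?F = space (Pr x)" by (simp add: space_Pr x)
    show "sets ?F \<subseteq> sets (Pr x)"
      using sets_image_in_sets[OF _ meas, of "space \<Omega>"] space_Pr[OF x] by simp
  qed
  interpret S: finite_measure_subalgebra "Pr x" ?F
    by unfold_locales (rule sub)
  note [measurable] = measurable_chain_Pr[OF x] B
  have AM[measurable]: "A \<in> sets (Pr x)" using A sub by (auto simp: subalgebra_def)
  let ?f = "\<lambda>\<omega>. indicator B (\<Phi> (Suc m) \<omega>) :: real"
  have int: "integrable (Pr x) ?f"
    by (rule M.integrable_const_bound[where B=1]) (auto simp: indicator_def)
  have Pm: "(\<lambda>\<omega>. measure (P (\<Phi> m \<omega>)) B) \<in> borel_measurable (Pr x)"
    using measurable_compose[OF measurable_chain_Pr[OF x]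
        measurable_compose[OF measurable_prob_algebraD[OF kernel] measurable_measure_subprob_algebra[OF B]]] .
  have bound: "norm (indicator A \<omega> * measure (P (\<Phi> m \<omega>)) B) \<le> 1" if "\<omega> \<in> space (Pr x)" for \<omega>
  proof -
    have "\<Phi> m \<omega> \<in> space X" using measurable_space[OF measurable_chain_Pr[OF x] that] .
    then interpret K: prob_space "P (\<Phi> m \<omega>)" by (rule prob_space_kernel)
    show ?thesis by (auto simp: indicator_def)
  qed
  have "(\<integral>\<omega>. indicator A \<omega> * ?f \<omega> \<partial>Pr x) = (\<integral>\<omega>. indicator A \<omega> * real_cond_exp (Pr x) ?F ?f \<omega> \<partial>Pr x)"
    using S.real_cond_exp_intA[OF int A] by (simp add: set_lebesgue_integral_def)
  also have "\<dots> = (\<integral>\<omega>. indicator A \<omega> * measure (P (\<Phi> m \<omega>)) B \<partial>Pr x)"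
    by (rule integral_cong_AE) (use markov_property[OF x B, of m] Pm in auto)
  finally have eq: "(\<integral>\<omega>. indicator A \<omega> * ?f \<omega> \<partial>Pr x) = (\<integral>\<omega>. indicator A \<omega> * measure (P (\<Phi> m \<omega>)) B \<partial>Pr x)" .
  have "(\<integral>\<^sup>+\<omega>. indicator A \<omega> * indicator B (\<Phi> (Suc m) \<omega>) \<partial>Pr x) = (\<integral>\<^sup>+\<omega>. ennreal (indicator A \<omega> * ?f \<omega>) \<partial>Pr x)"
    by (intro nn_integral_cong) (auto simp: indicator_def)
  also have "\<dots> = ennreal (\<integral>\<omega>. indicator A \<omega> * ?f \<omega> \<partial>Pr x)"
    by (intro nn_integral_eq_integral M.integrable_const_bound[where B=1]) (auto simp: indicator_def)
  also have "\<dots> = (\<integral>\<^sup>+\<omega>. ennreal (indicator A \<omega> * measure (P (\<Phi> m \<omega>)) B) \<partial>Pr x)"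
    unfolding eq using bound Pm
    by (intro nn_integral_eq_integral[symmetric] M.integrable_const_bound[where B=1]) auto
  also have "\<dots> = (\<integral>\<^sup>+\<omega>. indicator A \<omega> * emeasure (P (\<Phi> m \<omega>)) B \<partial>Pr x)"
  proof (rule nn_integral_cong)
    fix \<omega> assume "\<omega> \<in> space (Pr x)"
    then have "\<Phi> m \<omega> \<in> space X" using measurable_space[OF measurable_chain_Pr[OF x]] by blast
    then interpret K: prob_space "P (\<Phi> m \<omega>)" by (rule prob_space_kernel)
    show "ennreal (indicator A \<omega> * measure (P (\<Phi> m \<omega>)) B) = indicator A \<omega> * emeasure (P (\<Phi> m \<omega>)) B"
      by (auto simp: indicator_def K.emeasure_eq_measure)
  qed
  finally show ?thesis .
qed

text \<open>The indicator case passes to simple functions by linearity and to nonnegative measurable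
  functions by monotone convergence.\<close>

lemma markov_property_nn_integral:
  assumes x: "x \<in> space X" and f: "f \<in> borel_measurable X"
    and A: "A \<in> sets (vimage_algebra (space \<Omega>) (\<lambda>\<omega>. \<lambda>k\<in>{..m}. \<Phi> k \<omega>) (\<Pi>\<^sub>M k\<in>{..m}. X))"
    and AM: "A \<in> sets \<Omega>"
  shows "(\<integral>\<^sup>+\<omega>. indicator A \<omega> * f (\<Phi> (Suc m) \<omega>) \<partial>Pr x)
    = (\<integral>\<^sup>+\<omega>. indicator A \<omega> * (\<integral>\<^sup>+y. f y \<partial>P (\<Phi> m \<omega>)) \<partial>Pr x)"
proof -
  note [measurable] = measurable_chain_Pr[OF x]
  have [measurable]: "A \<in> sets (Pr x)" using AM sets_Pr[OF x] by simp
  have Phi: "\<Phi> k \<omega> \<in> space X" if "\<omega> \<in> space (Pr x)" for k \<omega>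
    using measurable_space[OF measurable_chain_Pr[OF x] that] .
  have K: "(\<lambda>\<omega>. \<integral>\<^sup>+y. h y \<partial>P (\<Phi> m \<omega>)) \<in> borel_measurable (Pr x)" if "h \<in> borel_measurable X" for h
    using measurable_compose[OF measurable_chain_Pr[OF x] measurable_nn_integral_kernel[OF that]] .
  have Km: "h \<in> borel_measurable (P (\<Phi> m \<omega>))" if "h \<in> borel_measurable X" "\<omega> \<in> space (Pr x)" for h \<omega>
    using that(1) measurable_cong_sets[OF sets_kernel[OF Phi[OF that(2)]] refl] by blast
  show ?thesis
    using f
  proof (induction rule: borel_measurable_induct)
    case (cong f g)
    have "(\<integral>\<^sup>+\<omega>. indicator A \<omega> * g (\<Phi> (Suc m) \<omega>) \<partial>Pr x) = (\<integral>\<^sup>+\<omega>. indicator A \<omega> * f (\<Phi> (Suc m) \<omega>) \<partial>Pr x)"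
      by (intro nn_integral_cong) (simp add: cong(3) Phi)
    moreover have "(\<integral>\<^sup>+\<omega>. indicator A \<omega> * (\<integral>\<^sup>+y. g y \<partial>P (\<Phi> m \<omega>)) \<partial>Pr x)
        = (\<integral>\<^sup>+\<omega>. indicator A \<omega> * (\<integral>\<^sup>+y. f y \<partial>P (\<Phi> m \<omega>)) \<partial>Pr x)"
      by (intro nn_integral_cong arg_cong2[where f="(*)"] refl) (simp add: cong(3) space_kernel Phi)
    ultimately show ?case using cong by simp
  next
    case (set B)
    have "(\<integral>\<^sup>+\<omega>. indicator A \<omega> * (\<integral>\<^sup>+y. indicator B y \<partial>P (\<Phi> m \<omega>)) \<partial>Pr x)
        = (\<integral>\<^sup>+\<omega>. indicator A \<omega> * emeasure (P (\<Phi> m \<omega>)) B \<partial>Pr x)"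
      by (intro nn_integral_cong) (simp add: set sets_kernel Phi)
    then show ?case using markov_property_indicator[OF x set A] by simp
  next
    case (mult u c)
    have "(\<integral>\<^sup>+\<omega>. indicator A \<omega> * (c * u (\<Phi> (Suc m) \<omega>)) \<partial>Pr x)
        = c * (\<integral>\<^sup>+\<omega>. indicator A \<omega> * u (\<Phi> (Suc m) \<omega>) \<partial>Pr x)"
      using mult(2) by (subst nn_integral_cmult[symmetric]) (auto simp: mult.left_commute)
    moreover have "(\<integral>\<^sup>+\<omega>. indicator A \<omega> * (\<integral>\<^sup>+y. c * u y \<partial>P (\<Phi> m \<omega>)) \<partial>Pr x)
        = (\<integral>\<^sup>+\<omega>. c * (indicator A \<omega> * (\<integral>\<^sup>+y. u y \<partial>P (\<Phi> m \<omega>))) \<partial>Pr x)"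
      by (intro nn_integral_cong) (simp add: nn_integral_cmult Km mult mult.left_commute)
    moreover have "\<dots> = c * (\<integral>\<^sup>+\<omega>. indicator A \<omega> * (\<integral>\<^sup>+y. u y \<partial>P (\<Phi> m \<omega>)) \<partial>Pr x)"
      by (intro nn_integral_cmult borel_measurable_times_ennreal K[OF mult(2)]) simp
    ultimately show ?case using mult by simp
  next
    case (add u v)
    have "(\<integral>\<^sup>+\<omega>. indicator A \<omega> * (v (\<Phi> (Suc m) \<omega>) + u (\<Phi> (Suc m) \<omega>)) \<partial>Pr x)
        = (\<integral>\<^sup>+\<omega>. indicator A \<omega> * v (\<Phi> (Suc m) \<omega>) \<partial>Pr x) + (\<integral>\<^sup>+\<omega>. indicator A \<omega> * u (\<Phi> (Suc m) \<omega>) \<partial>Pr x)"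
      using add by (subst nn_integral_add[symmetric]) (auto simp: distrib_left)
    moreover have "(\<integral>\<^sup>+\<omega>. indicator A \<omega> * (\<integral>\<^sup>+y. v y + u y \<partial>P (\<Phi> m \<omega>)) \<partial>Pr x)
        = (\<integral>\<^sup>+\<omega>. indicator A \<omega> * (\<integral>\<^sup>+y. v y \<partial>P (\<Phi> m \<omega>)) + indicator A \<omega> * (\<integral>\<^sup>+y. u y \<partial>P (\<Phi> m \<omega>)) \<partial>Pr x)"
      by (intro nn_integral_cong) (simp add: nn_integral_add Km add distrib_left)
    moreover have "\<dots> = (\<integral>\<^sup>+\<omega>. indicator A \<omega> * (\<integral>\<^sup>+y. v y \<partial>P (\<Phi> m \<omega>)) \<partial>Pr x)
        + (\<integral>\<^sup>+\<omega>. indicator A \<omega> * (\<integral>\<^sup>+y. u y \<partial>P (\<Phi> m \<omega>)) \<partial>Pr x)"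
      by (intro nn_integral_add borel_measurable_times_ennreal K add) simp_all
    ultimately show ?case using add by simp
  next
    case (seq U)
    have "(\<integral>\<^sup>+\<omega>. indicator A \<omega> * (SUP i. U i) (\<Phi> (Suc m) \<omega>) \<partial>Pr x)
        = (\<integral>\<^sup>+\<omega>. (SUP i. indicator A \<omega> * U i (\<Phi> (Suc m) \<omega>)) \<partial>Pr x)"
      by (simp add: SUP_apply SUP_mult_left_ennreal image_comp)
    also have "\<dots> = (SUP i. \<integral>\<^sup>+\<omega>. indicator A \<omega> * U i (\<Phi> (Suc m) \<omega>) \<partial>Pr x)"
      using seq by (intro nn_integral_monotone_convergence_SUP)
        (auto simp: incseq_def le_fun_def intro!: mult_left_mono)
    also have "\<dots> = (SUP i. \<integral>\<^sup>+\<omega>. indicator A \<omega> * (\<integral>\<^sup>+y. U i y \<partial>P (\<Phi> m \<omega>)) \<partial>Pr x)"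
      using seq by simp
    also have "\<dots> = (\<integral>\<^sup>+\<omega>. (SUP i. indicator A \<omega> * (\<integral>\<^sup>+y. U i y \<partial>P (\<Phi> m \<omega>))) \<partial>Pr x)"
      using seq(3) by (intro nn_integral_monotone_convergence_SUP[symmetric] borel_measurable_times_ennreal K seq)
        (auto simp: incseq_def le_fun_def intro!: mult_left_mono nn_integral_mono)
    also have "\<dots> = (\<integral>\<^sup>+\<omega>. indicator A \<omega> * (\<integral>\<^sup>+y. (SUP i. U i) y \<partial>P (\<Phi> m \<omega>)) \<partial>Pr x)"
    proof (rule nn_integral_cong)
      fix \<omega> assume w: "\<omega> \<in> space (Pr x)"
      have "(\<integral>\<^sup>+y. (SUP i. U i) y \<partial>P (\<Phi> m \<omega>)) = (\<integral>\<^sup>+y. (SUP i. U i y) \<partial>P (\<Phi> m \<omega>))"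
        by (simp add: SUP_apply image_comp)
      also have "\<dots> = (SUP i. \<integral>\<^sup>+y. U i y \<partial>P (\<Phi> m \<omega>))"
        by (intro nn_integral_monotone_convergence_SUP seq Km w)
      finally show "(SUP i. indicator A \<omega> * (\<integral>\<^sup>+y. U i y \<partial>P (\<Phi> m \<omega>)))
          = indicator A \<omega> * (\<integral>\<^sup>+y. (SUP i. U i) y \<partial>P (\<Phi> m \<omega>))"
        by (simp add: SUP_mult_left_ennreal image_comp)
    qed
    finally show ?case .
  qed
qed

lemma nn_integral_initial:
  assumes x: "x \<in> space X" and f: "f \<in> borel_measurable X"
  shows "(\<integral>\<^sup>+\<omega>. f (\<Phi> 0 \<omega>) \<partial>Pr x) = f x"
proof -
  have "(\<integral>\<^sup>+\<omega>. f (\<Phi> 0 \<omega>) \<partial>Pr x) = (\<integral>\<^sup>+y. f y \<partial>distr (Pr x) X (\<Phi> 0))"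
    using f by (subst nn_integral_distr) (simp_all add: measurable_chain_Pr x)
  then show ?thesis by (simp add: initial x nn_integral_return f)
qed

text \<open>The induction peels off the last step of the chain: \<open>f\<close> is replaced by its
  kernel integral, hence must be arbitrary.\<close>

lemma nn_integral_chain:
  assumes x: "x \<in> space X" and f: "f \<in> borel_measurable X"
  shows "(\<integral>\<^sup>+\<omega>. f (\<Phi> k \<omega>) \<partial>Pr x) = ((\<lambda>h x. \<integral>\<^sup>+y. h y \<partial>P x) ^^ k) f x"
  using f
proof (induction k arbitrary: f)
  case 0
  then show ?case by (simp add: nn_integral_initial x)
next
  case (Suc k)
  let ?F = "vimage_algebra (space \<Omega>) (\<lambda>\<omega>. \<lambda>j\<in>{..k}. \<Phi> j \<omega>) (\<Pi>\<^sub>M j\<in>{..k}. X)"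
  \<comment> \<open>Conditioning on the whole space turns the Markov property into an unconditional
    one-step identity.\<close>
  have "space \<Omega> \<in> sets ?F" using sets.top[of ?F] by simp
  from markov_property_nn_integral[OF x Suc(2) this]
  have "(\<integral>\<^sup>+\<omega>. indicator (space \<Omega>) \<omega> * f (\<Phi> (Suc k) \<omega>) \<partial>Pr x)
    = (\<integral>\<^sup>+\<omega>. indicator (space \<Omega>) \<omega> * (\<integral>\<^sup>+y. f y \<partial>P (\<Phi> k \<omega>)) \<partial>Pr x)" by simp
  moreover have "(\<integral>\<^sup>+\<omega>. indicator (space \<Omega>) \<omega> * h \<omega> \<partial>Pr x) = (\<integral>\<^sup>+\<omega>. h \<omega> \<partial>Pr x)" for h
    by (intro nn_integral_cong) (simp add: space_Pr x)
  ultimately have "(\<integral>\<^sup>+\<omega>. f (\<Phi> (Suc k) \<omega>) \<partial>Pr x) = (\<integral>\<^sup>+\<omega>. (\<integral>\<^sup>+y. f y \<partial>P (\<Phi> k \<omega>)) \<partial>Pr x)" by simp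
  also have "\<dots> = ((\<lambda>h x. \<integral>\<^sup>+y. h y \<partial>P x) ^^ k) (\<lambda>x. \<integral>\<^sup>+y. f y \<partial>P x) x"
    by (rule Suc.IH[OF measurable_nn_integral_kernel[OF Suc(2)]])
  finally show ?case by (simp only: funpow_Suc_right o_apply)
qed

section \<open>Truncated return times: monotonicity and sampling after a block of steps\<close>

lemma measurable_truncated_value:
  assumes C: "C \<in> sets X"
  shows "truncated_value P C g m s \<in> borel_measurable X"
proof (induction m arbitrary: s)
  case 0
  then show ?case by simp
next
  case (Suc m)
  have "(\<lambda>y. if y \<in> C then g (Suc s) else truncated_value P C g m (Suc s) y) \<in> borel_measurable X"
    using C Suc by (intro measurable_If_set) auto
  from measurable_nn_integral_kernel[OF this] show ?case by simp
qed

lemma measurable_stopped_value: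
  assumes C: "C \<in> sets X"
  shows "(\<lambda>y. if y \<in> C then g s else truncated_value P C g m s y) \<in> borel_measurable X"
  using C measurable_truncated_value[OF C] by (intro measurable_If_set) auto

lemma truncated_value_ge:
  assumes g: "mono g" and x: "x \<in> space X"
  shows "g s \<le> truncated_value P C g m s x"
  using x
proof (induction m arbitrary: s x)
  case 0
  then show ?case by simp
next
  case (Suc m)
  interpret prob_space "P x" by (rule prob_space_kernel[OF Suc(2)])
  have "g s = (\<integral>\<^sup>+y. g s \<partial>P x)" by (simp add: emeasure_space_1)
  also have "\<dots> \<le> (\<integral>\<^sup>+y. (if y \<in> C then g (Suc s) else truncated_value P C g m (Suc s) y) \<partial>P x)"
  proof (rule nn_integral_mono)
    fix y assume "y \<in> space (P x)"
    then show "g s \<le> (if y \<in> C then g (Suc s) else truncated_value P C g m (Suc s) y)"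
      using Suc(1)[of y "Suc s"] monoD[OF g, of s "Suc s"] by (auto simp: space_kernel Suc(2))
  qed
  also have "\<dots> = truncated_value P C g (Suc m) s x" by simp
  finally show ?case .
qed

lemma truncated_value_mono:
  assumes g: "mono g" and x: "x \<in> space X"
  shows "truncated_value P C g m s x \<le> truncated_value P C g (Suc m) s x"
  using x
proof (induction m arbitrary: s x)
  case 0
  then show ?case using truncated_value_ge[OF g, of x s C "Suc 0"] by simp
next
  case (Suc m)
  have "truncated_value P C g (Suc m) s x
    = (\<integral>\<^sup>+y. (if y \<in> C then g (Suc s) else truncated_value P C g m (Suc s) y) \<partial>P x)" by simp
  also have "\<dots> \<le> (\<integral>\<^sup>+y. (if y \<in> C then g (Suc s) else truncated_value P C g (Suc m) (Suc s) y) \<partial>P x)"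
    using Suc by (intro nn_integral_mono) (simp add: space_kernel del: truncated_value.simps)
  also have "\<dots> = truncated_value P C g (Suc (Suc m)) s x" by (rule truncated_value.simps(2)[symmetric])
  finally show ?case .
qed

text \<open>Ignoring visits to \<open>C\<close> before the last step of the block only enlarges the
  value, since stopping yields \<open>g\<close> at the current time. Monotonicity in the truncation
  level restores \<open>Suc m\<close> at each of these steps, so a whole block costs one level,
  whatever its length. Later inductions on \<open>m\<close> therefore count blocks, not
  steps.\<close>

lemma truncated_value_le_iterate:
  assumes g: "mono g" and x: "x \<in> space X"
  shows "truncated_value P C g (Suc m) s x \<le>
    ((\<lambda>h x. \<integral>\<^sup>+y. h y \<partial>P x) ^^ Suc k)
      (\<lambda>y. if y \<in> C then g (s + Suc k) else truncated_value P C g m (s + Suc k) y) x"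
  using x
proof (induction k arbitrary: s x)
  case 0
  then show ?case by (simp cong del: if_weak_cong)
next
  case (Suc k)
  have "truncated_value P C g (Suc m) s x \<le> (\<integral>\<^sup>+y. truncated_value P C g (Suc m) (Suc s) y \<partial>P x)"
    unfolding truncated_value.simps(2)[of P C g m s]
    using truncated_value_ge[OF g, of _ "Suc s"] truncated_value_mono[OF g, of _ C m "Suc s"]
    by (intro nn_integral_mono) (simp add: space_kernel Suc(2) del: truncated_value.simps)
  also have "\<dots> \<le> (\<integral>\<^sup>+y. ((\<lambda>h x. \<integral>\<^sup>+y. h y \<partial>P x) ^^ Suc k)
      (\<lambda>y. if y \<in> C then g (Suc s + Suc k) else truncated_value P C g m (Suc s + Suc k) y) y \<partial>P x)"
    using Suc by (intro nn_integral_mono) (simp add: space_kernel del: truncated_value.simps funpow.simps)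
  finally show ?case by (simp cong del: if_weak_cong)
qed

text \<open>The return time is at most \<open>k\<close> if the chain is in \<open>C\<close> at time \<open>k\<close>, and at most
  \<open>k\<close> plus the return time of the shifted chain otherwise.\<close>

lemma truncated_value_le_chain:
  assumes g: "mono g" and x: "x \<in> space X" and C: "C \<in> sets X" and k: "1 \<le> k"
  shows "truncated_value P C g (Suc m) s x \<le>
    (\<integral>\<^sup>+\<omega>. (if \<Phi> k \<omega> \<in> C then g (s + k) else truncated_value P C g m (s + k) (\<Phi> k \<omega>)) \<partial>Pr x)"
  using truncated_value_le_iterate[OF g x, of C m s "k - 1"] k
    nn_integral_chain[OF x measurable_stopped_value[OF C, of g "s + k" m], of k]
  by (simp cong del: if_weak_cong del: truncated_value.simps funpow.simps)

section \<open>From truncated values to the expectation of the rate at the return time\<close>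

lemma no_return_Suc:
  "no_return \<Omega> \<Phi> C (Suc k) = {\<omega> \<in> no_return \<Omega> \<Phi> C k. \<Phi> (Suc k) \<omega> \<notin> C}"
  by (auto simp: no_return_def atLeastAtMostSuc_conv)

lemma no_return_in_sets:
  assumes [measurable]: "C \<in> sets X"
  shows "no_return \<Omega> \<Phi> C k \<in> sets \<Omega>"
proof -
  note [measurable] = measurable_chain
  show ?thesis unfolding no_return_def by measurable
qed

lemma first_return_in_sets:
  assumes C: "C \<in> sets X"
  shows "{\<omega> \<in> no_return \<Omega> \<Phi> C k. \<Phi> (Suc k) \<omega> \<in> C} \<in> sets \<Omega>"
proof -
  have "{\<omega> \<in> no_return \<Omega> \<Phi> C k. \<Phi> (Suc k) \<omega> \<in> C}
    = no_return \<Omega> \<Phi> C k \<inter> (\<Phi> (Suc k) -` C \<inter> space \<Omega>)"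
    by (auto simp: no_return_def)
  then show ?thesis using no_return_in_sets[OF C] measurable_sets[OF measurable_chain C] by auto
qed

lemma no_return_in_history:
  assumes C: "C \<in> sets X"
  shows "no_return \<Omega> \<Phi> C k \<in>
    sets (vimage_algebra (space \<Omega>) (\<lambda>\<omega>. \<lambda>j\<in>{..k}. \<Phi> j \<omega>) (\<Pi>\<^sub>M j\<in>{..k}. X))"
proof -
  let ?S = "{p \<in> space (\<Pi>\<^sub>M j\<in>{..k}. X). \<forall>j\<in>{1..k}. p j \<notin> C}"
  have "{p \<in> space (\<Pi>\<^sub>M j\<in>{..k}. X). p j \<notin> C} \<in> sets (\<Pi>\<^sub>M j\<in>{..k}. X)" if "j \<in> {1..k}" for j
  proof -
    have [measurable]: "(\<lambda>p. p j) \<in> (\<Pi>\<^sub>M j\<in>{..k}. X) \<rightarrow>\<^sub>M X"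
      using that by (intro measurable_component_singleton) auto
    show ?thesis using C by measurable
  qed
  then have S: "?S \<in> sets (\<Pi>\<^sub>M j\<in>{..k}. X)"
    by (intro sets.sets_Collect_finite_All) auto
  have sp: "(\<lambda>j\<in>{..k}. \<Phi> j \<omega>) \<in> space (\<Pi>\<^sub>M j\<in>{..k}. X)" if "\<omega> \<in> space \<Omega>" for \<omega>
    using measurable_space[OF measurable_chain that] by (auto simp: space_PiM)
  have "no_return \<Omega> \<Phi> C k = (\<lambda>\<omega>. \<lambda>j\<in>{..k}. \<Phi> j \<omega>) -` ?S \<inter> space \<Omega>"
    using sp by (auto simp: no_return_def)
  then show ?thesis using in_vimage_algebra[OF S] by (simp only:)
qed

text \<open>Paths that have returned by time \<open>k\<close> contribute \<open>g\<close> at their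
  return time, the others the value still to be expected from time \<open>k\<close> on. The Markov
  property on \<open>no_return\<close> moves \<open>k\<close> forward by one without changing the
  integral. For \<open>m = 0\<close> the integrand is \<open>g\<close> at the minimum of the return
  time and \<open>k\<close>.\<close>

lemma nn_integral_truncated:
  assumes x: "x \<in> space X" and C: "C \<in> sets X"
  shows "(\<integral>\<^sup>+\<omega>. (\<Sum>j<k. indicator {\<omega> \<in> no_return \<Omega> \<Phi> C j. \<Phi> (Suc j) \<omega> \<in> C} \<omega> * g (Suc j))
      + indicator (no_return \<Omega> \<Phi> C k) \<omega> * truncated_value P C g m k (\<Phi> k \<omega>) \<partial>Pr x)
    = truncated_value P C g (k + m) 0 x"
proof (induction k arbitrary: m)
  case 0
  have "(\<integral>\<^sup>+\<omega>. indicator (no_return \<Omega> \<Phi> C 0) \<omega> * truncated_value P C g m 0 (\<Phi> 0 \<omega>) \<partial>Pr x)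
      = (\<integral>\<^sup>+\<omega>. truncated_value P C g m 0 (\<Phi> 0 \<omega>) \<partial>Pr x)"
    by (intro nn_integral_cong) (simp add: no_return_def space_Pr x)
  then show ?case
    using nn_integral_initial[OF x measurable_truncated_value[OF C]] by simp
next
  case (Suc k)
  let ?N = "no_return \<Omega> \<Phi> C"
  let ?D = "\<lambda>j. {\<omega> \<in> ?N j. \<Phi> (Suc j) \<omega> \<in> C}"
  let ?L = "\<lambda>\<omega>. \<Sum>j<k. indicator (?D j) \<omega> * g (Suc j)"
  let ?S = "\<lambda>y. if y \<in> C then g (Suc k) else truncated_value P C g m (Suc k) y"
  note [measurable] = measurable_chain_Pr[OF x] C
  have [measurable]: "?N j \<in> sets (Pr x)" for j
    using no_return_in_sets[OF C] sets_Pr[OF x] by simp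
  have [measurable]: "?D j \<in> sets (Pr x)" for j
    using first_return_in_sets[OF C] sets_Pr[OF x] by simp
  note [measurable] = measurable_truncated_value[OF C] measurable_stopped_value[OF C]
  \<comment> \<open>On \<open>?N k\<close> the next state either lies in \<open>C\<close>, giving
    the new summand of the sum, or the path stays in \<open>?N (Suc k)\<close>. Both outcomes
    together are \<open>?S\<close> at the next state, a function to which the Markov property
    applies.\<close>
  have "(\<integral>\<^sup>+\<omega>. (\<Sum>j<Suc k. indicator (?D j) \<omega> * g (Suc j))
      + indicator (?N (Suc k)) \<omega> * truncated_value P C g m (Suc k) (\<Phi> (Suc k) \<omega>) \<partial>Pr x)
    = (\<integral>\<^sup>+\<omega>. ?L \<omega> + indicator (?N k) \<omega> * ?S (\<Phi> (Suc k) \<omega>) \<partial>Pr x)"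
    by (intro nn_integral_cong) (auto simp: no_return_Suc indicator_def)
  also have "\<dots> = (\<integral>\<^sup>+\<omega>. ?L \<omega> \<partial>Pr x) + (\<integral>\<^sup>+\<omega>. indicator (?N k) \<omega> * ?S (\<Phi> (Suc k) \<omega>) \<partial>Pr x)"
    by (intro nn_integral_add) measurable
  also have "(\<integral>\<^sup>+\<omega>. indicator (?N k) \<omega> * ?S (\<Phi> (Suc k) \<omega>) \<partial>Pr x)
      = (\<integral>\<^sup>+\<omega>. indicator (?N k) \<omega> * truncated_value P C g (Suc m) k (\<Phi> k \<omega>) \<partial>Pr x)"
    using markov_property_nn_integral[OF x measurable_stopped_value[OF C]
        no_return_in_history[OF C] no_return_in_sets[OF C], of k g "Suc k" m] by simp
  also have "(\<integral>\<^sup>+\<omega>. ?L \<omega> \<partial>Pr x) + \<dots>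
      = (\<integral>\<^sup>+\<omega>. ?L \<omega> + indicator (?N k) \<omega> * truncated_value P C g (Suc m) k (\<Phi> k \<omega>) \<partial>Pr x)"
    by (intro nn_integral_add[symmetric]) measurable
  also have "\<dots> = truncated_value P C g (k + Suc m) 0 x" by (rule Suc.IH)
  finally show ?case by simp
qed

text \<open>Monotone convergence: \<open>?H k\<close> is \<open>g\<close> at the minimum of the
  return time and \<open>k\<close>. It increases with \<open>k\<close>, and its supremum dominates
  the rate at the return time, so a bound uniform in the truncation carries over.\<close>

lemma nn_integral_rate_return_time_le:
  assumes x: "x \<in> space X" and C: "C \<in> sets X" and g: "mono g"
    and gR: "\<And>k. 1 \<le> k \<Longrightarrow> g k = ennreal (R (real k))"
    and R: "strict_mono_on {0<..} R"
    and bound: "\<And>m. truncated_value P C g m 0 x \<le> B"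
  shows "(\<integral>\<^sup>+\<omega>. rate_at R (return_time \<Phi> C \<omega>) \<partial>Pr x) \<le> B"
proof -
  let ?N = "no_return \<Omega> \<Phi> C"
  let ?D = "\<lambda>j. {\<omega> \<in> ?N j. \<Phi> (Suc j) \<omega> \<in> C}"
  let ?H = "\<lambda>k \<omega>. (\<Sum>j<k. indicator (?D j) \<omega> * g (Suc j)) + indicator (?N k) \<omega> * g k"
  note [measurable] = measurable_chain_Pr[OF x] C
  have [measurable]: "?N j \<in> sets (Pr x)" for j
    using no_return_in_sets[OF C] sets_Pr[OF x] by simp
  have [measurable]: "?D j \<in> sets (Pr x)" for j
    using first_return_in_sets[OF C] sets_Pr[OF x] by simp
  have "?H k \<omega> \<le> ?H (Suc k) \<omega>" for k \<omega>
    using monoD[OF g, of k "Suc k"] by (auto simp: no_return_Suc indicator_def intro!: add_left_mono)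
  then have inc: "incseq ?H" by (intro incseq_SucI le_funI)
  \<comment> \<open>This covers paths that never return. By monotonicity the limit is the supremum
    of \<open>R\<close> over the positive reals, and positive integers suffice to reach it.\<close>
  have lim: "Lim at_top (\<lambda>s. ennreal (R s)) \<le> (SUP k. g k)"
  proof -
    let ?S = "SUP s\<in>{0<..}. ennreal (R s)"
    have mono: "ennreal (R s) \<le> ennreal (R t)" if "0 < s" "s \<le> t" for s t
      using strict_mono_onD[OF R, of s t] that by (cases "s = t") (auto intro!: ennreal_leI)
    have "((\<lambda>s. ennreal (R s)) \<longlongrightarrow> ?S) at_top"
    proof (rule order_tendstoI)
      fix a assume "a < ?S"
      then obtain s where s: "0 < s" "a < ennreal (R s)" by (auto simp: less_SUP_iff)
      then have "a < ennreal (R t)" if "t \<ge> s" for t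
        using mono[OF s(1) that] by (rule_tac less_le_trans)
      then show "\<forall>\<^sub>F t in at_top. a < ennreal (R t)" by (auto simp: eventually_at_top_linorder)
    next
      fix a assume a: "?S < a"
      have "ennreal (R t) < a" if "t \<ge> 1" for t
        by (rule le_less_trans[OF SUP_upper a]) (use that in auto)
      then show "\<forall>\<^sub>F t in at_top. ennreal (R t) < a" by (auto simp: eventually_at_top_linorder)
    qed
    then have "Lim at_top (\<lambda>s. ennreal (R s)) = ?S" by (intro tendsto_Lim) auto
    also have "\<dots> \<le> (SUP k. g k)"
    proof (rule SUP_least)
      fix s :: real assume s: "s \<in> {0<..}"
      obtain k where "s \<le> real k" using real_arch_simple by blast
      then have "1 \<le> k" "ennreal (R s) \<le> ennreal (R (real k))" using s mono by (auto simp: Suc_le_eq intro: ccontr)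
      then show "ennreal (R s) \<le> (SUP k. g k)" using gR by (intro SUP_upper2[of k]) auto
    qed
    finally show ?thesis .
  qed
  have pointwise: "rate_at R (return_time \<Phi> C \<omega>) \<le> (SUP k. ?H k \<omega>)" if w: "\<omega> \<in> space (Pr x)" for \<omega>
  proof (cases "\<exists>k\<ge>1. \<Phi> k \<omega> \<in> C")
    case True
    define k where "k = (LEAST k. 1 \<le> k \<and> \<Phi> k \<omega> \<in> C)"
    have k: "1 \<le> k" "\<Phi> k \<omega> \<in> C" using LeastI_ex[OF True] by (auto simp: k_def)
    have least: "k \<le> j" if "1 \<le> j" "\<Phi> j \<omega> \<in> C" for j
      unfolding k_def by (rule Least_le) (use that in auto)
    have "return_time \<Phi> C \<omega> = enat k"
      unfolding return_time_def using k least
      by (intro antisym Inf_lower Inf_greatest) auto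
    then have "rate_at R (return_time \<Phi> C \<omega>) = g k" using gR[OF k(1)] by (simp add: rate_at_def)
    also have "\<dots> \<le> ?H k \<omega>"
    proof -
      \<comment> \<open>\<open>?D j\<close> is the event that the return time equals
        \<open>Suc j\<close>, hence the shift by one.\<close>
      have "\<omega> \<in> ?D (k - 1)"
        using k w least space_Pr[OF x] by (force simp: no_return_def)
      then have "g k = indicator (?D (k - 1)) \<omega> * g (Suc (k - 1))" using k by simp
      also have "\<dots> \<le> (\<Sum>j<k. indicator (?D j) \<omega> * g (Suc j))"
        using k by (intro member_le_sum) auto
      also have "\<dots> \<le> ?H k \<omega>" by simp
      finally show ?thesis .
    qed
    also have "\<dots> \<le> (SUP k. ?H k \<omega>)" by (rule SUP_upper) simp
    finally show ?thesis .
  next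
    case False
    then have "{k. 1 \<le> k \<and> \<Phi> k \<omega> \<in> C} = {}" by auto
    then have "return_time \<Phi> C \<omega> = \<infinity>" by (simp add: return_time_def Inf_enat_def)
    then have "rate_at R (return_time \<Phi> C \<omega>) = Lim at_top (\<lambda>s. ennreal (R s))" by (simp add: rate_at_def)
    also note lim
    also have "(SUP k. g k) \<le> (SUP k. ?H k \<omega>)"
    proof (rule SUP_mono)
      fix k
      have "\<omega> \<in> ?N k" using False w by (auto simp: no_return_def space_Pr x)
      then show "\<exists>k'\<in>UNIV. g k \<le> ?H k' \<omega>" by (intro bexI[of _ k]) auto
    qed
    finally show ?thesis .
  qed
  have "(\<integral>\<^sup>+\<omega>. rate_at R (return_time \<Phi> C \<omega>) \<partial>Pr x) \<le> (\<integral>\<^sup>+\<omega>. (SUP k. ?H k \<omega>) \<partial>Pr x)"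
    by (rule nn_integral_mono[OF pointwise])
  also have "\<dots> = (SUP k. \<integral>\<^sup>+\<omega>. ?H k \<omega> \<partial>Pr x)"
    by (intro nn_integral_monotone_convergence_SUP inc) measurable
  also have "\<dots> = (SUP k. truncated_value P C g k 0 x)"
    using nn_integral_truncated[OF x C, where g=g and m=0] by simp
  also have "\<dots> \<le> B" by (intro SUP_least bound)
  finally show ?thesis .
qed

text \<open>The initial condition fixes only the law of \<open>\<Phi> 0\<close>. The level set of
  \<open>n\<close> through \<open>x\<close> is measurable, so it has full mass under this law even
  if the singleton of \<open>x\<close> is not measurable.\<close>

lemma nn_integral_chain_random_time:
  assumes x: "x \<in> space X" and n: "n \<in> X \<rightarrow>\<^sub>M count_space UNIV"
  shows "(\<integral>\<^sup>+\<omega>. f (\<Phi> (n (\<Phi> 0 \<omega>)) \<omega>) \<partial>Pr x) = (\<integral>\<^sup>+\<omega>. f (\<Phi> (n x) \<omega>) \<partial>Pr x)"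
proof (rule nn_integral_cong_AE)
  have m: "{y \<in> space X. n y = n x} \<in> sets X" using n by measurable
  have "AE y in distr (Pr x) X (\<Phi> 0). n y = n x"
    unfolding initial[OF x] using x m by (subst AE_return) (auto simp: pred_def)
  then have "AE \<omega> in Pr x. n (\<Phi> 0 \<omega>) = n x"
    using AE_distr_iff[OF measurable_chain_Pr[OF x] m] by simp
  then show "AE \<omega> in Pr x. f (\<Phi> (n (\<Phi> 0 \<omega>)) \<omega>) = f (\<Phi> (n x) \<omega>)" by eventually_elim simp
qed

end

section \<open>Real analysis of the rate function: log-concave derivative, convex growth,
  subadditivity\<close>

lemma log_concave_on_quotient_antimono:
  fixes D :: "real \<Rightarrow> real"
  assumes D: "log_concave_on {0<..} D" and t: "0 < t" "t \<le> u" and s: "0 \<le> s"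
  shows "D (s + u) * D t \<le> D (s + t) * D u"
proof -
  have pos: "0 < D v" if "0 < v" for v using D that by (simp add: log_concave_on_def)
  have conc: "concave_on {0<..} (\<lambda>t. ln (D t))" using D by (simp add: log_concave_on_def)
  have "ln (D (s + u)) + ln (D t) \<le> ln (D (s + t)) + ln (D u)"
  proof (cases "s + u = t")
    case True
    then have "s = 0" "u = t" using t s by auto
    then show ?thesis by simp
  next
    case False
    \<comment> \<open>The points \<open>s + t\<close> and \<open>u\<close> lie between
      \<open>t\<close> and \<open>s + u\<close> and have the same sum. The weights \<open>l\<close>
      and \<open>1 - l\<close> write them as convex combinations of the outer points; adding the two
      concavity inequalities cancels the weights.\<close>
    define l where "l = s / (s + u - t)"
    have L: "0 < s + u - t" using False t s by linarith
    have l: "0 \<le> l" "l \<le> 1" using L t s by (auto simp: l_def)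
    have lL: "l * (s + u - t) = s" using L by (simp add: l_def)
    have 1: "(1 - l) * t + l * (s + u) = s + t" "(1 - (1 - l)) * t + (1 - l) * (s + u) = u"
      using lL by (auto simp: algebra_simps)
    have "(1 - l) * ln (D t) + l * ln (D (s + u)) \<le> ln (D (s + t))"
      using concave_onD[OF conc l, of t "s + u"] t s 1 by simp
    moreover have "l * ln (D t) + (1 - l) * ln (D (s + u)) \<le> ln (D u)"
      using concave_onD[OF conc, of "1 - l" t "s + u"] l t s 1 by simp
    ultimately show ?thesis by (simp add: algebra_simps)
  qed
  then have "ln (D (s + u) * D t) \<le> ln (D (s + t) * D u)"
    using pos t s by (simp add: ln_mult pos add_nonneg_pos less_imp_neq[symmetric] less_le_trans[OF t(1)])
  then show ?thesis
    using pos t s by (subst (asm) ln_le_cancel_iff) (auto intro!: mult_pos_pos)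
qed

text \<open>Equivalently, \<open>v \<mapsto> R (s + R\<inverse> v)\<close> is concave: this is its supporting line at \<open>v = R t\<^sub>0\<close>.\<close>

lemma log_concave_deriv_supporting_line:
  fixes R D :: "real \<Rightarrow> real"
  assumes R: "\<And>t. 0 < t \<Longrightarrow> (R has_real_derivative D t) (at t)"
    and D: "log_concave_on {0<..} D" and t0: "0 < t0" and s: "0 \<le> s"
  shows "\<exists>c\<ge>0. \<forall>t>0. R (s + t) \<le> R (s + t0) + c * (R t - R t0)"
proof -
  have pos: "0 < D v" if "0 < v" for v using D that by (simp add: log_concave_on_def)
  \<comment> \<open>By the chain rule this is the slope of v \<mapsto> R (s + R^{-1} v) at v = R
    t0.\<close>
  define c where "c = D (s + t0) / D t0"
  have D0: "0 < D t0" "0 < D (s + t0)" using pos t0 s by auto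
  have c: "0 \<le> c" using D0 by (simp add: c_def)
  have deriv: "((\<lambda>t. R (s + t) - c * R t) has_real_derivative D (s + t) - c * D t) (at t)" if "0 < t" for t
    using that s by (auto intro!: derivative_eq_intros DERIV_chain2[OF R] R)
  \<comment> \<open>The quotient of \<open>D (s + t)\<close> by \<open>D t\<close> is non-increasing
    in \<open>t\<close> and equals \<open>c\<close> at \<open>t0\<close>. So this difference
    increases up to \<open>t0\<close> and decreases afterwards.\<close>
  have "R (s + t) - c * R t \<le> R (s + t0) - c * R t0" if t: "0 < t" for t
  proof (cases "t \<le> t0")
    case True
    have "0 \<le> D (s + u) - c * D u" if "t \<le> u" "u \<le> t0" for u
      using log_concave_on_quotient_antimono[OF D, of u t0 s] that t s D0
      by (simp add: c_def field_simps)
    then show ?thesis using t deriv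
      by (intro DERIV_nonneg_imp_nondecreasing[OF True]) (meson less_le_trans)
  next
    case False
    have "D (s + u) - c * D u \<le> 0" if "t0 \<le> u" for u
      using log_concave_on_quotient_antimono[OF D t0 that s] D0
      by (simp add: c_def field_simps)
    moreover have "t0 \<le> t" using False by simp
    ultimately show ?thesis using t0 deriv
      by (intro DERIV_nonpos_imp_nonincreasing[where f="\<lambda>t. R (s + t) - c * R t"]) (meson less_le_trans)+
  qed
  then show ?thesis using c by (intro exI[of _ c]) (auto simp: algebra_simps)
qed

text \<open>By convexity the chord from 1 to any \<open>t\<close> at least 2 is at least as steep as
  the chord from 1 to 2, whose slope \<open>d\<close> is positive. Hence \<open>R\<close> grows at
  least linearly.\<close>

lemma convex_strict_mono_unbounded:
  fixes R :: "real \<Rightarrow> real"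
  assumes "convex_on {0<..} R" "strict_mono_on {0<..} R"
  shows "\<exists>N::nat. \<forall>k\<ge>N. v < R (real k)"
proof -
  define d where "d = R 2 - R 1"
  have d: "0 < d" using strict_mono_onD[OF assms(2), of 1 2] by (simp add: d_def)
  have line: "R 1 + d * (t - 1) \<le> R t" if t: "2 \<le> t" for t
  proof -
    define l where "l = 1 / (t - 1)"
    have l: "0 \<le> l" "l \<le> 1" "l * (t - 1) = 1" using t by (auto simp: l_def)
    have "(1 - l) * 1 + l * t = 2" using l(3) by (simp add: algebra_simps)
    then have "R 2 = R ((1 - l) * 1 + l * t)" by (simp only:)
    also have "\<dots> \<le> (1 - l) * R 1 + l * R t"
      using convex_onD[OF assms(1) l(1,2), of 1 t] t by simp
    finally have "R 2 \<le> (1 - l) * R 1 + l * R t" .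
    then have "d \<le> l * (R t - R 1)" by (simp add: d_def algebra_simps)
    then have "d * (t - 1) \<le> l * (R t - R 1) * (t - 1)" using t by (intro mult_right_mono) auto
    also have "\<dots> = (l * (t - 1)) * (R t - R 1)" by (simp add: algebra_simps)
    finally show ?thesis using l(3) by simp
  qed
  obtain N :: nat where N: "2 + \<bar>v - R 1\<bar> / d + 1 < real N" using reals_Archimedean2 by blast
  show ?thesis
  proof (intro exI[of _ N] allI impI)
    fix k assume "N \<le> k"
    then have k: "2 + \<bar>v - R 1\<bar> / d + 1 < real k" using N by linarith
    have "0 \<le> \<bar>v - R 1\<bar> / d" using d by simp
    then have k2: "2 \<le> real k" using k by linarith
    have "\<bar>v - R 1\<bar> / d < real k - 1" using k by linarith
    then have "v - R 1 < d * (real k - 1)" using d by (simp add: field_simps)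
    then show "v < R (real k)" using line[OF k2] by linarith
  qed
qed

text \<open>Split \<open>R (s + t)\<close> in the proportion \<open>s\<close> to \<open>t\<close>;
  each share has the quotient of the larger argument \<open>s + t\<close>, which is the smaller
  one.\<close>

lemma antimono_quotient_subadditive:
  fixes R :: "real \<Rightarrow> real"
  assumes "antimono_on {0<..} (\<lambda>t. R t / t)" "0 < s" "0 < t"
  shows "R (s + t) \<le> R s + R t"
proof -
  have "R (s + t) / (s + t) \<le> R s / s" "R (s + t) / (s + t) \<le> R t / t"
    using assms by (auto simp: monotone_on_def)
  then have "s * (R (s + t) / (s + t)) \<le> R s" "t * (R (s + t) / (s + t)) \<le> R t"
    using assms(2,3) by (auto simp: field_simps)
  moreover have "R (s + t) = s * (R (s + t) / (s + t)) + t * (R (s + t) / (s + t))"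
    unfolding distrib_right[symmetric] using assms(2,3) by simp
  ultimately show ?thesis by linarith
qed

text \<open>Nothing is known about \<open>R 0\<close>; the value 0 keeps the sequence monotone.\<close>

definition rate_seq :: "(real \<Rightarrow> real) \<Rightarrow> nat \<Rightarrow> ennreal" where
  "rate_seq R k = (if k = 0 then 0 else ennreal (R (real k)))"

lemma rate_seq_le: "strict_mono_on {0<..} R \<Longrightarrow> 0 < t \<Longrightarrow> real k \<le> t \<Longrightarrow> rate_seq R k \<le> ennreal (R t)"
  using strict_mono_onD[of "{0<..}" R "real k" t]
  by (cases "real k = t") (auto simp: rate_seq_def intro!: ennreal_leI)

lemma mono_rate_seq:
  assumes "strict_mono_on {0<..} R"
  shows "mono (rate_seq R)"
proof
  fix j k :: nat assume "j \<le> k"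
  then show "rate_seq R j \<le> rate_seq R k"
    using rate_seq_le[OF assms, of "real k" j] by (cases "k = 0") (auto simp: rate_seq_def)
qed

section \<open>Bounds on truncated values under the drift condition\<close>

context markov_chain
begin

text \<open>Integrating \<open>W \<ge> 1\<close> against a probability measure gives at least 1. As
  \<open>ennreal\<close> sends negative reals to 0, this is what makes the drift bound a genuine
  real number bound, for \<open>b\<close> of either sign.\<close>

lemma drift_ge_1:
  assumes x: "x \<in> space X" and W: "\<And>x. x \<in> space X \<Longrightarrow> 1 \<le> W x"
    and drift: "(\<integral>\<^sup>+\<omega>. ennreal (W (\<Phi> k \<omega>)) \<partial>Pr x) \<le> ennreal w"
  shows "1 \<le> w"
proof -
  interpret prob_space "Pr x" by (rule prob_space_Pr[OF x])
  have "ennreal 1 = (\<integral>\<^sup>+\<omega>. ennreal 1 \<partial>Pr x)" by (simp add: emeasure_space_1)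
  also have "\<dots> \<le> (\<integral>\<^sup>+\<omega>. ennreal (W (\<Phi> k \<omega>)) \<partial>Pr x)"
    using measurable_space[OF measurable_chain_Pr[OF x]] W by (intro nn_integral_mono ennreal_leI) auto
  also note drift
  finally show ?thesis by (simp add: ennreal_le_iff2)
qed

text \<open>Induction over blocks. The bound is a fixed point of the recursion: the cost
  \<open>W x\<close> of one block plus the drift bound divided by \<open>1 - \<beta>\<close> is
  again (W x + b 1_C(x)) / (1 - \<beta>), the sum of the geometric series.\<close>

lemma truncated_value_subadditive_rate:
  fixes W :: "'a \<Rightarrow> real"
  assumes C: "C \<in> sets X" and W: "\<And>x. x \<in> space X \<Longrightarrow> 1 \<le> W x" and Wm: "W \<in> borel_measurable X"
    and n: "\<And>x. x \<in> space X \<Longrightarrow> 1 \<le> n x" and \<beta>: "\<beta> < 1"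
    and drift: "\<And>x. x \<in> space X \<Longrightarrow>
      (\<integral>\<^sup>+\<omega>. ennreal (W (\<Phi> (n x) \<omega>)) \<partial>Pr x) \<le> ennreal (\<beta> * W x + b * indicator C x)"
    and g: "mono g" "\<And>s x. x \<in> space X \<Longrightarrow> g (s + n x) \<le> g s + ennreal (W x)"
    and x: "x \<in> space X"
  shows "truncated_value P C g m s x \<le> g s + ennreal ((W x + b * indicator C x) / (1 - \<beta>))"
  using x
proof (induction m arbitrary: s x)
  case 0
  then show ?case by simp
next
  case (Suc m)
  interpret prob_space "Pr x" by (rule prob_space_Pr[OF Suc(2)])
  note [measurable] = measurable_chain_Pr[OF Suc(2)] Wm
  let ?w = "\<beta> * W x + b * indicator C x"
  have w: "1 \<le> ?w" by (rule drift_ge_1[OF Suc(2) W drift[OF Suc(2)]])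
  have "truncated_value P C g (Suc m) s x \<le>
      (\<integral>\<^sup>+\<omega>. (if \<Phi> (n x) \<omega> \<in> C then g (s + n x) else truncated_value P C g m (s + n x) (\<Phi> (n x) \<omega>)) \<partial>Pr x)"
    by (rule truncated_value_le_chain[OF g(1) Suc(2) C n[OF Suc(2)]])
  \<comment> \<open>The recursion continues only from states outside \<open>C\<close>, where the
    induction hypothesis has no \<open>b\<close> term.\<close>
  also have "\<dots> \<le> (\<integral>\<^sup>+\<omega>. g (s + n x) + ennreal (1 / (1 - \<beta>)) * ennreal (W (\<Phi> (n x) \<omega>)) \<partial>Pr x)"
  proof (rule nn_integral_mono)
    fix \<omega> assume "\<omega> \<in> space (Pr x)"
    then have y: "\<Phi> (n x) \<omega> \<in> space X" using measurable_space[OF measurable_chain_Pr[OF Suc(2)]] by blast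
    show "(if \<Phi> (n x) \<omega> \<in> C then g (s + n x) else truncated_value P C g m (s + n x) (\<Phi> (n x) \<omega>))
      \<le> g (s + n x) + ennreal (1 / (1 - \<beta>)) * ennreal (W (\<Phi> (n x) \<omega>))"
      using Suc(1)[OF y, of "s + n x"] W[OF y] \<beta> by (auto simp: ennreal_mult[symmetric])
  qed
  also have "\<dots> = g (s + n x) + ennreal (1 / (1 - \<beta>)) * (\<integral>\<^sup>+\<omega>. ennreal (W (\<Phi> (n x) \<omega>)) \<partial>Pr x)"
    by (simp add: nn_integral_add nn_integral_cmult emeasure_space_1)
  also have "\<dots> \<le> (g s + ennreal (W x)) + ennreal (1 / (1 - \<beta>)) * ennreal ?w"
    by (intro add_mono mult_left_mono g drift Suc) simp
  also have "ennreal (1 / (1 - \<beta>)) * ennreal ?w = ennreal (?w / (1 - \<beta>))"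
    using w \<beta> by (simp add: ennreal_mult[symmetric])
  also have "(g s + ennreal (W x)) + ennreal (?w / (1 - \<beta>)) = g s + ennreal (W x + ?w / (1 - \<beta>))"
    using w \<beta> W[OF Suc(2)] by (simp add: ennreal_plus add.assoc)
  also have "W x + ?w / (1 - \<beta>) = (W x + b * indicator C x) / (1 - \<beta>)"
    using \<beta> by (simp add: field_simps)
  finally show ?case .
qed

text \<open>Jensen's inequality in supporting-line form; \<open>r\<close> plays the role of \<open>R\<inverse> \<circ> W\<close>.\<close>

lemma nn_integral_supporting_line_le:
  fixes W :: "'a \<Rightarrow> real" and R :: "real \<Rightarrow> real"
  assumes W: "\<And>x. x \<in> space X \<Longrightarrow> 1 \<le> W x" and Wm: "W \<in> borel_measurable X"
    and drift: "(\<integral>\<^sup>+\<omega>. ennreal (W (\<Phi> k \<omega>)) \<partial>Pr x) \<le> ennreal w"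
    and R: "\<And>t. 0 < t \<Longrightarrow> 0 < R t"
    and r: "\<And>x. x \<in> space X \<Longrightarrow> 0 < r x \<and> R (r x) = W x"
    and u: "0 \<le> u" and c: "0 \<le> c" "\<And>t. 0 < t \<Longrightarrow> R (u + t) \<le> R (u + t0) + c * (R t - R t0)"
    and x: "x \<in> space X"
  shows "(\<integral>\<^sup>+\<omega>. ennreal (R (u + r (\<Phi> k \<omega>))) \<partial>Pr x) \<le> ennreal (R (u + t0) + c * (w - R t0))"
proof -
  interpret prob_space "Pr x" by (rule prob_space_Pr[OF x])
  note [measurable] = measurable_chain_Pr[OF x] Wm
  have y: "\<Phi> k \<omega> \<in> space X" if "\<omega> \<in> space (Pr x)" for \<omega>
    using measurable_space[OF measurable_chain_Pr[OF x] that] .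
  have w: "1 \<le> w" by (rule drift_ge_1[OF x W drift])
  \<comment> \<open>The supporting line at \<open>t = r (\<Phi> k \<omega>)\<close>, where
    \<open>R t\<close> is \<open>W\<close>. It is affine in \<open>W\<close>, so its expectation
    depends only on the mean of \<open>W\<close>; it is nonnegative because it dominates a value of
    \<open>R\<close>.\<close>
  let ?f = "\<lambda>\<omega>. R (u + t0) + c * (W (\<Phi> k \<omega>) - R t0)"
  have le: "R (u + r (\<Phi> k \<omega>)) \<le> ?f \<omega>" if "\<omega> \<in> space (Pr x)" for \<omega>
    using c(2)[of "r (\<Phi> k \<omega>)"] r[OF y[OF that]] by simp
  have pos: "0 \<le> ?f \<omega>" if "\<omega> \<in> space (Pr x)" for \<omega>
  proof -
    have "0 < u + r (\<Phi> k \<omega>)" using r[OF y[OF that]] u by simp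
    then show ?thesis using le[OF that] R by (meson less_imp_le order_trans)
  qed
  have "AE \<omega> in Pr x. 0 \<le> W (\<Phi> k \<omega>)"
    using W[OF y] by (intro AE_I2) (auto intro: order_trans[of 0 1])
  moreover from this have int: "integrable (Pr x) (\<lambda>\<omega>. W (\<Phi> k \<omega>))"
    by (intro integrableI_nonneg) (auto intro: le_less_trans[OF drift])
  ultimately have "ennreal (\<integral>\<omega>. W (\<Phi> k \<omega>) \<partial>Pr x) \<le> ennreal w"
    using drift by (simp add: nn_integral_eq_integral)
  then have mean: "(\<integral>\<omega>. W (\<Phi> k \<omega>) \<partial>Pr x) \<le> w" using w by (simp add: ennreal_le_iff)
  have "(\<integral>\<^sup>+\<omega>. ennreal (R (u + r (\<Phi> k \<omega>))) \<partial>Pr x) \<le> (\<integral>\<^sup>+\<omega>. ennreal (?f \<omega>) \<partial>Pr x)"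
    by (intro nn_integral_mono ennreal_leI le)
  also have "\<dots> = ennreal (\<integral>\<omega>. ?f \<omega> \<partial>Pr x)"
    using int pos by (intro nn_integral_eq_integral AE_I2) auto
  also have "(\<integral>\<omega>. ?f \<omega> \<partial>Pr x) = R (u + t0) + c * ((\<integral>\<omega>. W (\<Phi> k \<omega>) \<partial>Pr x) - R t0)"
    using int by (simp add: prob_space)
  finally show ?thesis using mean c(1) by (elim order_trans) (intro ennreal_leI add_left_mono mult_left_mono, auto)
qed

text \<open>Induction over blocks, with the supporting line taken at \<open>q x\<close>. Outside
  \<open>C\<close> the drift bound is exactly \<open>R (q x)\<close>, so the linear term vanishes.
  What remains, \<open>R (s + n x + q x)\<close>, is at most \<open>R (s + r x)\<close> by
  \<open>rq\<close>.\<close>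

lemma truncated_value_log_concave_rate:
  fixes W :: "'a \<Rightarrow> real"
  assumes C: "C \<in> sets X" and W: "\<And>x. x \<in> space X \<Longrightarrow> 1 \<le> W x" and Wm: "W \<in> borel_measurable X"
    and n: "\<And>x. x \<in> space X \<Longrightarrow> 1 \<le> n x"
    and drift: "\<And>x. x \<in> space X \<Longrightarrow>
      (\<integral>\<^sup>+\<omega>. ennreal (W (\<Phi> (n x) \<omega>)) \<partial>Pr x) \<le> ennreal (\<beta> * W x + b * indicator C x)"
    and R: "\<And>t. 0 < t \<Longrightarrow> 0 < R t" and Rm: "strict_mono_on {0<..} R"
    and support: "\<And>s t0. 0 < t0 \<Longrightarrow> 0 \<le> s \<Longrightarrow> \<exists>c\<ge>0. \<forall>t>0. R (s + t) \<le> R (s + t0) + c * (R t - R t0)"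
    and r: "\<And>x. x \<in> space X \<Longrightarrow> 0 < r x \<and> R (r x) = W x"
    and q: "\<And>x. x \<in> space X \<Longrightarrow> 0 < q x \<and> R (q x) = \<beta> * W x"
    and rq: "\<And>x. x \<in> space X \<Longrightarrow> real (n x) \<le> r x - q x"
    and x: "x \<in> space X" "x \<notin> C"
  shows "truncated_value P C (rate_seq R) m s x \<le> ennreal (R (real s + r x))"
  using x
proof (induction m arbitrary: s x)
  case 0
  then show ?case using r[of x] rate_seq_le[OF Rm, of "real s + r x" s] by (simp add: add_nonneg_pos)
next
  case (Suc m)
  note x = Suc(2)
  let ?k = "s + n x"
  obtain c where c: "0 \<le> c" "\<forall>t>0. R (real ?k + t) \<le> R (real ?k + q x) + c * (R t - R (q x))"
    using support[of "q x" "real ?k"] q[OF x] by auto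
  have "truncated_value P C (rate_seq R) (Suc m) s x \<le>
      (\<integral>\<^sup>+\<omega>. (if \<Phi> (n x) \<omega> \<in> C then rate_seq R ?k
        else truncated_value P C (rate_seq R) m ?k (\<Phi> (n x) \<omega>)) \<partial>Pr x)"
    by (rule truncated_value_le_chain[OF mono_rate_seq[OF Rm] x C n[OF x]])
  also have "\<dots> \<le> (\<integral>\<^sup>+\<omega>. ennreal (R (real ?k + r (\<Phi> (n x) \<omega>))) \<partial>Pr x)"
  proof (rule nn_integral_mono)
    fix \<omega> assume "\<omega> \<in> space (Pr x)"
    then have y: "\<Phi> (n x) \<omega> \<in> space X" using measurable_space[OF measurable_chain_Pr[OF x]] by blast
    have "rate_seq R ?k \<le> ennreal (R (real ?k + r (\<Phi> (n x) \<omega>)))"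
      by (rule rate_seq_le[OF Rm]) (use r[OF y] in auto)
    then show "(if \<Phi> (n x) \<omega> \<in> C then rate_seq R ?k
        else truncated_value P C (rate_seq R) m ?k (\<Phi> (n x) \<omega>)) \<le> ennreal (R (real ?k + r (\<Phi> (n x) \<omega>)))"
      using Suc(1)[OF y, of ?k] by auto
  qed
  also have "\<dots> \<le> ennreal (R (real ?k + q x) + c * ((\<beta> * W x + b * indicator C x) - R (q x)))"
    by (rule nn_integral_supporting_line_le[OF W Wm drift[OF x] R r]) (use c x in auto)
  also have "\<dots> = ennreal (R (real ?k + q x))" using q[OF x] Suc(3) by simp
  also have "\<dots> \<le> ennreal (R (real s + r x))"
  proof (rule ennreal_leI, rule monotone_onD[OF strict_mono_on_imp_mono_on[OF Rm]])
  qed (use q[OF x] r[OF x] rq[OF x] in auto)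
  finally show ?case .
qed

end

section \<open>The two cases of the theorem and the choice of the constant\<close>

theorem theorem3p2:
  fixes X :: "'a measure"
    and P :: "'a \<Rightarrow> 'a measure"
    and \<Omega> :: "'w measure"
    and Pr :: "'a \<Rightarrow> 'w measure"
    and \<Phi> :: "nat \<Rightarrow> 'w \<Rightarrow> 'a"
    and W :: "'a \<Rightarrow> real"
    and n :: "'a \<Rightarrow> nat"
    and \<beta> b :: real
    and C :: "'a set"
    and R :: "real \<Rightarrow> real"
  assumes chain: "markov_chain X P \<Omega> Pr \<Phi>"
    and W_measurable: "W \<in> borel_measurable X"
    and W_ge_1: "\<And>x. x \<in> space X \<Longrightarrow> 1 \<le> W x"
    and n_measurable: "n \<in> X \<rightarrow>\<^sub>M count_space UNIV"
    and n_ge_1: "\<And>x. x \<in> space X \<Longrightarrow> 1 \<le> n x"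
    and \<beta>: "0 < \<beta>" "\<beta> < 1"
    and C_measurable: "C \<in> sets X"
    and drift: "\<And>x. x \<in> space X \<Longrightarrow>
      (\<integral>\<^sup>+\<omega>. ennreal (W (\<Phi> (n (\<Phi> 0 \<omega>)) \<omega>)) \<partial>Pr x) \<le> ennreal (\<beta> * W x + b * indicator C x)"
    and R_pos: "\<And>t. 0 < t \<Longrightarrow> 0 < R t"
    and R_mono: "strict_mono_on {0<..} R"
    and R_cases:
      "(antimono_on {0<..} (\<lambda>t. R t / t) \<and> (\<forall>x\<in>space X. R (real (n x)) \<le> W x))
       \<or> (convex_on {0<..} R \<and> R C1_differentiable_on {0<..} \<and> log_concave_on {0<..} (deriv R)
          \<and> (\<forall>x\<in>space X. W x \<in> R ` {0<..} \<and> \<beta> * W x \<in> R ` {0<..}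
               \<and> inv_into {0<..} R (W x) - inv_into {0<..} R (\<beta> * W x) \<ge> real (n x)))"
  shows "\<exists>K::real. \<forall>x\<in>space X.
    (\<integral>\<^sup>+\<omega>. rate_at R (return_time \<Phi> C \<omega>) \<partial>Pr x) \<le> ennreal (K * (W x + b * indicator C x))"
proof -
  interpret markov_chain X P \<Omega> Pr \<Phi> by (rule chain)
  let ?w = "\<lambda>x. W x + b * indicator C x"
  have drift_n: "(\<integral>\<^sup>+\<omega>. ennreal (W (\<Phi> (n x) \<omega>)) \<partial>Pr x) \<le> ennreal (\<beta> * W x + b * indicator C x)"
    if "x \<in> space X" for x
    using drift[OF that] nn_integral_chain_random_time[OF that n_measurable, of "\<lambda>y. ennreal (W y)"] by simp
  have w_ge_1: "1 \<le> \<beta> * W x + b * indicator C x" if "x \<in> space X" for x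
    by (rule drift_ge_1[OF that W_ge_1 drift_n[OF that]])
  have return_le: "(\<integral>\<^sup>+\<omega>. rate_at R (return_time \<Phi> C \<omega>) \<partial>Pr x) \<le> B"
    if "x \<in> space X" "\<And>m. truncated_value P C (rate_seq R) m 0 x \<le> B" for x B
    using nn_integral_rate_return_time_le[OF that(1) C_measurable mono_rate_seq[OF R_mono] _ R_mono that(2)]
    by (simp add: rate_seq_def)
  from R_cases show ?thesis
  proof
    assume R: "antimono_on {0<..} (\<lambda>t. R t / t) \<and> (\<forall>x\<in>space X. R (real (n x)) \<le> W x)"
    \<comment> \<open>Subadditivity is available at positive arguments only. For
      \<open>s = 0\<close> the convention in \<open>rate_seq\<close> reduces the claim to the
      hypothesis that \<open>R\<close> at \<open>n x\<close> is at most \<open>W x\<close>.\<close>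
    have rate: "rate_seq R (s + n x) \<le> rate_seq R s + ennreal (W x)" if x: "x \<in> space X" for s x
    proof (cases "s = 0")
      case True
      then show ?thesis using R x n_ge_1[OF x] by (auto simp: rate_seq_def intro!: ennreal_leI)
    next
      case False
      have "R (real s + real (n x)) \<le> R (real s) + R (real (n x))"
        using R False n_ge_1[OF x] by (intro antimono_quotient_subadditive) auto
      also have "\<dots> \<le> R (real s) + W x" using R x by simp
      finally show ?thesis using False R_pos[of "real s"] W_ge_1[OF x]
        by (simp add: rate_seq_def ennreal_plus[symmetric] ennreal_leI del: ennreal_plus)
    qed
    show ?thesis
    proof (intro exI[of _ "1 / (1 - \<beta>)"] ballI return_le)
      fix x m assume "x \<in> space X"
      from truncated_value_subadditive_rate[OF C_measurable W_ge_1 W_measurable n_ge_1 \<beta>(2) drift_n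
          mono_rate_seq[OF R_mono] rate this, of m 0]
      show "truncated_value P C (rate_seq R) m 0 x \<le> ennreal (1 / (1 - \<beta>) * (W x + b * indicator C x))"
        by (simp add: rate_seq_def[of R 0])
    qed
  next
    assume R: "convex_on {0<..} R \<and> R C1_differentiable_on {0<..} \<and> log_concave_on {0<..} (deriv R)
      \<and> (\<forall>x\<in>space X. W x \<in> R ` {0<..} \<and> \<beta> * W x \<in> R ` {0<..}
        \<and> inv_into {0<..} R (W x) - inv_into {0<..} R (\<beta> * W x) \<ge> real (n x))"
    have "(R has_real_derivative deriv R t) (at t)" if t: "0 < t" for t
    proof -
      obtain D where "\<forall>t\<in>{0<..}. (R has_vector_derivative D t) (at t)"
        using R unfolding C1_differentiable_on_def by blast
      then have "(R has_real_derivative D t) (at t)"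
        using t by (simp add: has_real_derivative_iff_has_vector_derivative)
      then show ?thesis using DERIV_imp_deriv by metis
    qed
    then have support: "\<exists>c\<ge>0. \<forall>t>0. R (s + t) \<le> R (s + t0) + c * (R t - R t0)" if "0 < t0" "0 \<le> s" for s t0
      using R that by (intro log_concave_deriv_supporting_line) auto
    define r where "r x = inv_into {0<..} R (W x)" for x
    define q where "q x = inv_into {0<..} R (\<beta> * W x)" for x
    have r: "0 < r x \<and> R (r x) = W x" and q: "0 < q x \<and> R (q x) = \<beta> * W x" if "x \<in> space X" for x
      using R that inv_into_into[of "W x" R "{0<..}"] inv_into_into[of "\<beta> * W x" R "{0<..}"]
      by (auto simp: r_def q_def f_inv_into_f)
    have rq: "real (n x) \<le> r x - q x" if "x \<in> space X" for x
      using R that by (simp add: r_def q_def)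
    have Rle: "R s \<le> R t" if "0 < s" "s \<le> t" for s t
      using strict_mono_onD[OF R_mono, of s t] that by (cases "s = t") auto
    have outside: "truncated_value P C (rate_seq R) m s x \<le> ennreal (R (real s + r x))"
      if "x \<in> space X" "x \<notin> C" for m s x
      by (rule truncated_value_log_concave_rate[OF C_measurable W_ge_1 W_measurable n_ge_1 drift_n R_pos R_mono
          support r q rq that])
    \<comment> \<open>One block from an arbitrary state, in \<open>C\<close> or not, followed by
      \<open>outside\<close> with elapsed time \<open>n x\<close>. The point \<open>t0\<close> and
      slope \<open>c\<close> stay free because large and small values of \<open>W\<close> need
      different choices.\<close>
    have general: "truncated_value P C (rate_seq R) m 0 x \<le>
        ennreal (R (real (n x) + t0) + c * ((\<beta> * W x + b * indicator C x) - R t0))"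
      if x: "x \<in> space X" and t0: "0 < t0" and c: "0 \<le> c"
        "\<And>t. 0 < t \<Longrightarrow> R (real (n x) + t) \<le> R (real (n x) + t0) + c * (R t - R t0)" for m x t0 c
    proof -
      have "truncated_value P C (rate_seq R) m 0 x \<le> truncated_value P C (rate_seq R) (Suc m) 0 x"
        by (rule truncated_value_mono[OF mono_rate_seq[OF R_mono] x])
      also have "\<dots> \<le> (\<integral>\<^sup>+\<omega>. (if \<Phi> (n x) \<omega> \<in> C then rate_seq R (0 + n x)
          else truncated_value P C (rate_seq R) m (0 + n x) (\<Phi> (n x) \<omega>)) \<partial>Pr x)"
        by (rule truncated_value_le_chain[OF mono_rate_seq[OF R_mono] x C_measurable n_ge_1[OF x]])
      also have "\<dots> \<le> (\<integral>\<^sup>+\<omega>. ennreal (R (real (n x) + r (\<Phi> (n x) \<omega>))) \<partial>Pr x)"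
      proof (rule nn_integral_mono)
        fix \<omega> assume "\<omega> \<in> space (Pr x)"
        then have y: "\<Phi> (n x) \<omega> \<in> space X" using measurable_space[OF measurable_chain_Pr[OF x]] by blast
        have "rate_seq R (n x) \<le> ennreal (R (real (n x) + r (\<Phi> (n x) \<omega>)))"
          by (rule rate_seq_le[OF R_mono]) (use r[OF y] in auto)
        then show "(if \<Phi> (n x) \<omega> \<in> C then rate_seq R (0 + n x)
            else truncated_value P C (rate_seq R) m (0 + n x) (\<Phi> (n x) \<omega>))
          \<le> ennreal (R (real (n x) + r (\<Phi> (n x) \<omega>)))"
          using outside[OF y, of m "n x"] by auto
      qed
      also have "\<dots> \<le> ennreal (R (real (n x) + t0) + c * ((\<beta> * W x + b * indicator C x) - R t0))"
        by (rule nn_integral_supporting_line_le[OF W_ge_1 W_measurable drift_n[OF x] R_pos r _ c x]) auto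
      finally show ?thesis .
    qed
    \<comment> \<open>If \<open>\<beta> * W x < 2 * R 1\<close>, then R(n(x)) \<le> W(x) < 2 R(1) /
      \<beta>, which forces \<open>n x < N\<close>.\<close>
    obtain N :: nat where N: "\<And>k. N \<le> k \<Longrightarrow> 2 * R 1 / \<beta> < R (real k)"
      using convex_strict_mono_unbounded[of R "2 * R 1 / \<beta>"] R R_mono by blast
    have "\<forall>k. \<exists>c\<ge>0. \<forall>t>0. R (real k + t) \<le> R (real k + 1) + c * (R t - R 1)"
      by (intro allI support) auto
    then obtain c1 where c1: "\<And>k. 0 \<le> c1 k"
      "\<And>k t. 0 < t \<Longrightarrow> R (real k + t) \<le> R (real k + 1) + c1 k * (R t - R 1)" by metis
    \<comment> \<open>Bounds the estimate \<open>general\<close> at \<open>t0 = 1\<close> when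
      \<open>n x = k\<close> and \<open>\<beta> * W x < 2 * R 1\<close>.\<close>
    define B where "B k = R (real k + 1) + c1 k * (2 * R 1 + \<bar>b\<bar>)" for k :: nat
    have R1: "0 < R 1" by (rule R_pos) simp
    have B: "0 \<le> B k" for k
      using c1(1)[of k] R_pos[of "real k + 1"] R1 by (simp add: B_def)
    \<comment> \<open>The first term absorbs \<open>W x\<close>, the second the \<open>b\<close>
      term times a slope of at most \<open>2 / \<beta>\<close>, and the sum covers the finitely many
      block lengths below \<open>N\<close>.\<close>
    define K where "K = 1 / (1 - \<beta>) + 2 * \<bar>b\<bar> / \<beta> + (\<Sum>k<N. B k)"
    \<comment> \<open>\<open>?w x\<close> is the drift bound, which is at least 1, plus
      \<open>(1 - \<beta>) * W x\<close>. Both lower bounds hold even for negative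
      \<open>b\<close>.\<close>
    have w: "1 \<le> ?w x" "(1 - \<beta>) * W x \<le> ?w x" if x: "x \<in> space X" for x
    proof -
      have "\<beta> * W x \<le> 1 * W x" using \<beta> W_ge_1[OF x] by (intro mult_right_mono) auto
      then show "1 \<le> ?w x" using w_ge_1[OF x] by linarith
      have "(1 - \<beta>) * W x = W x - \<beta> * W x" by (simp add: algebra_simps)
      then show "(1 - \<beta>) * W x \<le> ?w x" using w_ge_1[OF x] by linarith
    qed
    have sum_B: "0 \<le> (\<Sum>k<N. B k)" using B by (intro sum_nonneg) auto
    have K: "W x + v \<le> K * ?w x" if x: "x \<in> space X" and v: "v \<le> 2 * \<bar>b\<bar> / \<beta>" for x v
    proof -
      have "W x \<le> 1 / (1 - \<beta>) * ?w x" using w(2)[OF x] \<beta> by (simp add: field_simps)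
      then have "W x + v \<le> 1 / (1 - \<beta>) * ?w x + 2 * \<bar>b\<bar> / \<beta> * 1" using v by simp
      also have "\<dots> \<le> 1 / (1 - \<beta>) * ?w x + 2 * \<bar>b\<bar> / \<beta> * ?w x"
        using w(1)[OF x] \<beta> by (intro add_left_mono mult_left_mono) auto
      also have "\<dots> \<le> K * ?w x"
        unfolding distrib_right[symmetric] K_def using sum_B w(1)[OF x] by (intro mult_right_mono) auto
      finally show ?thesis .
    qed
    show ?thesis
    proof (intro exI[of _ K] ballI return_le)
      fix x m assume x: "x \<in> space X"
      show "truncated_value P C (rate_seq R) m 0 x \<le> ennreal (K * ?w x)"
      \<comment> \<open>At this threshold \<open>R 1\<close> is at most half of
        \<open>R (q x)\<close>, so the point 1 is low enough to control the slope of the line at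
        \<open>q x\<close>.\<close>
      proof (cases "2 * R 1 \<le> \<beta> * W x")
        case True
        obtain c where c: "0 \<le> c"
          "\<And>t. 0 < t \<Longrightarrow> R (real (n x) + t) \<le> R (real (n x) + q x) + c * (R t - R (q x))"
          using support[of "q x" "real (n x)"] q[OF x] by auto
        have RW: "R (real (n x) + q x) \<le> W x"
          using Rle[of "real (n x) + q x" "r x"] r[OF x] q[OF x] rq[OF x] by simp
        \<comment> \<open>The supporting line at \<open>q x\<close> is nonnegative at \<open>t = 1\<close>, which bounds its slope.\<close>
        have "0 \<le> W x + c * (R 1 - \<beta> * W x)"
          using c(2)[of 1] R_pos[of "real (n x) + 1"] RW q[OF x] by simp
        also have "\<dots> \<le> W x + c * (- (\<beta> * W x / 2))"
          using True c(1) by (intro add_left_mono mult_left_mono) auto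
        finally have "(c * \<beta>) * W x \<le> 2 * W x" by simp
        then have "c * \<beta> \<le> 2" using W_ge_1[OF x] by (subst (asm) mult_le_cancel_right) auto
        then have "c \<le> 2 / \<beta>" using \<beta> by (simp add: field_simps)
        then have "c * \<bar>b\<bar> \<le> 2 / \<beta> * \<bar>b\<bar>" by (intro mult_right_mono) auto
        moreover have "c * (b * indicator C x) \<le> c * \<bar>b\<bar>"
          using c(1) by (intro mult_left_mono) (auto simp: indicator_def)
        ultimately have "c * (b * indicator C x) \<le> 2 * \<bar>b\<bar> / \<beta>" by simp
        \<comment> \<open>Since \<open>R (q x)\<close> equals \<open>\<beta> * W x\<close>, only the
          \<open>b\<close> term survives behind the slope.\<close>
        then have "R (real (n x) + q x) + c * ((\<beta> * W x + b * indicator C x) - R (q x)) \<le> K * ?w x"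
          using K[OF x, of "c * (b * indicator C x)"] RW q[OF x] by simp
        then show ?thesis
          using general[OF x _ c, of m] q[OF x] by (blast intro: order_trans ennreal_leI)
      next
        case False
        have "R (real (n x)) \<le> W x"
          using Rle[of "real (n x)" "r x"] r[OF x] q[OF x] rq[OF x] n_ge_1[OF x] by simp
        also have "\<dots> < 2 * R 1 / \<beta>" using False \<beta> by (simp add: field_simps)
        finally have "n x < N" using N[of "n x"] by (rule_tac ccontr) auto
        then have "B (n x) \<le> (\<Sum>k<N. B k)" using B by (intro member_le_sum) auto
        also have "\<dots> \<le> K" using \<beta> by (simp add: K_def)
        also have "\<dots> \<le> K * ?w x"
        proof -
          have "0 \<le> K" using \<beta> sum_B by (simp add: K_def)
          then show ?thesis using mult_left_mono[OF w(1)[OF x], of K] by simp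
        qed
        finally have le: "B (n x) \<le> K * ?w x" .
        have "c1 (n x) * ((\<beta> * W x + b * indicator C x) - R 1) \<le> c1 (n x) * (2 * R 1 + \<bar>b\<bar>)"
          using False R1 c1(1)[of "n x"] by (intro mult_left_mono) (auto simp: indicator_def)
        then have "R (real (n x) + 1) + c1 (n x) * ((\<beta> * W x + b * indicator C x) - R 1) \<le> K * ?w x"
          using le by (simp add: B_def)
        then show ?thesis
          using general[OF x _ c1(1)[of "n x"] c1(2), of m] by (auto intro: order_trans ennreal_leI)
      qed
    qed
  qed
qed

end
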